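(* Let $E$ be a separable normed space over $\mathbb{C}$. There exist two complex vector spaces $F_1, F_2\subseteq U(T,E)\cup\{0\}$ (vector subspaces of $H(T,E)$), each dense in $H(T,E)$, such that $F_1\cap F_2=\{0\}$.
   Context: Here $\mathbb{N}=\{1,2,3,\dots\}$. $T$ is the set of vertices of a rooted tree with root $x_0$. $T_0=\{x_0\}$ and, for $n\in\mathbb{N}$, $T_n$ is the set of vertices at distance $n$ from $x_0$. For $x\in T$, $S(x)$ denotes the set of children of $x$. It is assumed that every $T_n$ is finite and every $S(x)$ has at least two elements (so $T$ is countably infinite). For each $x\in T$ and $y\in S(x)$ a real number $q(x,y)>0$ is given, with $\sum_{y\in S(x)}q(x,y)=1$ for every $x\in T$. Also fixed are weights $w(x,y)\in\mathbb{C}\setminus\{0\}$ for $x\in T$, $y\in S(x)$, with $\sum_{y\in S(x)}w(x,y)=1$ for every $x\in T$. Boundary: $\partial T$ is the set of infinite geodesics from $x_0$, i.e. sets $e=\{z_n:n\in\mathbb{N}\}$ with $z_1=x_0$ and $z_{n+1}\in S(z_n)$ for all $n$. For $x\in T$, $B_x=\{e\in\partial T: x\in e\}$. For $n\in\mathbb{N}$, $\mathcal{M}_n$ is the $\sigma$-algebra on $\partial T$ generated by the finite partition $\{B_x:x\in T_n\}$. For $x\in T_n$, with path $y_0=x_0,\dots,y_n=x$, $y_{j+1}\in S(y_j)$, put $p(B_x)=\prod_{j=0}^{n-1}q(y_j,y_{j+1})$; this determines a probability measure $\mathbb{P}_n$ on $\mathcal{M}_n$. By Kolmogorov's consistency theorem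 there is a probability measure $\mathbb{P}$ on $(\partial T,\mathcal{M})$, where $\mathcal{M}$ is the completion of the $\sigma$-algebra generated by $\bigcup_n\mathcal{M}_n$, with $\mathbb{P}|_{\mathcal{M}_n}=\mathbb{P}_n$ for all $n$. Let $d$ be the metric of $E$ induced by its norm. $L^0(\partial T,E)$ is the space of $\mathcal{M}$-measurable functions $\partial T\to E$ (preimages of open sets lie in $\mathcal{M}$), modulo almost everywhere equality, with the metric $P(\psi,\phi)=\int_{\partial T}\frac{d(\psi(e),\phi(e))}{1+d(\psi(e),\phi(e))}\,d\mathbb{P}(e)$ (topology of convergence in probability). $E^T$ carries the metric $\rho(f,g)=\sum_{n=1}^\infty 2^{-n}\frac{d(f(z_n),g(z_n))}{1+d(f(z_n),g(z_n))}$, where $\{z_n:n\in\mathbb{N}\}$ is an enumeration of $T$ (topology of pointwise convergence). A function $f:T\to E$ is (generalized) harmonic if $f(x)=\sum_{y\in S(x)}w(x,y)f(y)$ for all $x\in T$; $H(T,E)\subseteq E^T$ is the set of these functions, with the subspace topology. For $f\in H(T,E)$ and $n\in\mathbb{N}$, $\omega_n(f):\partial T\to E$ is given by $\omega_n(f)(e)=f(z)$, where $z$ is the unique element of $e\cap T_n$. A function $f\in H(T,E)$ is universal if the sequence $\{\omega_n(f)\}_{n=1}^\infty$ is dense in $L^0(\partial T,E)$; $U(T,E)$ denotes the set of universal functions. *)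

theory Defs
  imports "HOL-Analysis.Analysis" "HOL-Library.Function_Algebras"
begin

section \<open>Complex normed spaces\<close>

class complex_normed_vector = real_normed_vector +
  fixes scaleC :: "complex \<Rightarrow> 'a \<Rightarrow> 'a"  (infixr "*\<^sub>C" 75)
  assumes scaleC_add_right: "c *\<^sub>C (x + y) = c *\<^sub>C x + c *\<^sub>C y"
    and scaleC_add_left: "(c + c') *\<^sub>C x = c *\<^sub>C x + c' *\<^sub>C x"
    and scaleC_scaleC: "c *\<^sub>C c' *\<^sub>C x = (c * c') *\<^sub>C x"
    and scaleR_scaleC: "r *\<^sub>R x = complex_of_real r *\<^sub>C x"
    and norm_scaleC: "norm (c *\<^sub>C x) = cmod c * norm x"

lemma scaleC_one: "1 *\<^sub>C (x :: 'a::complex_normed_vector) = x"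
  using scaleR_scaleC[of 1 x] by simp

text \<open>Pointwise complex scalar multiplication. Addition and zero of functions are those of
  \<open>Function_Algebras\<close>.\<close>

definition scaleC_fun :: "complex \<Rightarrow> ('v \<Rightarrow> 'e) \<Rightarrow> 'v \<Rightarrow> 'e::complex_normed_vector"
  where "scaleC_fun c f = (\<lambda>x. c *\<^sub>C f x)"

text \<open>Together with this fact, \<open>module.subspace scaleC_fun\<close> is the library's notion of a linear
  subspace, here over the complex numbers.\<close>

lemma vector_space_scaleC_fun:
  "vector_space (scaleC_fun :: complex \<Rightarrow> ('v \<Rightarrow> 'e) \<Rightarrow> 'v \<Rightarrow> 'e::complex_normed_vector)"
  by unfold_locales
    (simp_all add: scaleC_fun_def fun_eq_iff scaleC_add_right scaleC_add_left scaleC_scaleC scaleC_one)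

definition dense_in :: "('a \<Rightarrow> 'a \<Rightarrow> real) \<Rightarrow> 'a set \<Rightarrow> 'a set \<Rightarrow> bool"
  where "dense_in d A X \<longleftrightarrow> A \<subseteq> X \<and> (\<forall>x\<in>X. \<forall>\<epsilon>>0. \<exists>a\<in>A. d a x < \<epsilon>)"


section \<open>Rooted trees\<close>

text \<open>The vertices are the elements of the type \<open>'v\<close>; \<open>S x\<close> is the set of children of \<open>x\<close>.\<close>

definition root_path :: "'v \<Rightarrow> ('v \<Rightarrow> 'v set) \<Rightarrow> 'v \<Rightarrow> 'v list \<Rightarrow> bool"
  where "root_path x0 S x ys \<longleftrightarrow>
    ys \<noteq> [] \<and> hd ys = x0 \<and> last ys = x \<and> successively (\<lambda>u v. v \<in> S u) ys"

definition rooted_tree :: "'v \<Rightarrow> ('v \<Rightarrow> 'v set) \<Rightarrow> bool"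
  where "rooted_tree x0 S \<longleftrightarrow> (\<forall>x. \<exists>!ys. root_path x0 S x ys)"

definition level :: "'v \<Rightarrow> ('v \<Rightarrow> 'v set) \<Rightarrow> nat \<Rightarrow> 'v set"
  where "level x0 S n = {x. \<exists>ys. root_path x0 S x ys \<and> length ys = Suc n}"


section \<open>The boundary and its measure\<close>

definition boundary :: "'v \<Rightarrow> ('v \<Rightarrow> 'v set) \<Rightarrow> 'v set set"
  where "boundary x0 S = {range z | z. z (0::nat) = x0 \<and> (\<forall>n. z (Suc n) \<in> S (z n))}"

definition cylinder :: "'v \<Rightarrow> ('v \<Rightarrow> 'v set) \<Rightarrow> 'v \<Rightarrow> 'v set set"
  where "cylinder x0 S x = {e \<in> boundary x0 S. x \<in> e}"

definition level_algebra :: "'v \<Rightarrow> ('v \<Rightarrow> 'v set) \<Rightarrow> nat \<Rightarrow> 'v set set set"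
  where "level_algebra x0 S n =
    sigma_sets (boundary x0 S) (cylinder x0 S ` level x0 S n)"

definition cylinder_prob ::
    "'v \<Rightarrow> ('v \<Rightarrow> 'v set) \<Rightarrow> ('v \<Rightarrow> 'v \<Rightarrow> real) \<Rightarrow> 'v \<Rightarrow> real"
  where "cylinder_prob x0 S q x =
    (let ys = THE ys. root_path x0 S x ys
     in \<Prod>j<length ys - 1. q (ys ! j) (ys ! Suc j))"

text \<open>The Kolmogorov extension before completion. Since \<open>level_algebra x0 S n\<close> is generated by a
  finite partition into cylinders, prescribing the values on cylinders determines the
  restriction of \<open>\<mu>\<close> to it.\<close>

definition kolmogorov_extension ::
    "'v \<Rightarrow> ('v \<Rightarrow> 'v set) \<Rightarrow> ('v \<Rightarrow> 'v \<Rightarrow> real) \<Rightarrow> 'v set measure \<Rightarrow> bool"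
  where "kolmogorov_extension x0 S q \<mu> \<longleftrightarrow>
    space \<mu> = boundary x0 S \<and>
    sets \<mu> = sigma_sets (boundary x0 S) (\<Union>n\<in>{1..}. level_algebra x0 S n) \<and>
    emeasure \<mu> (space \<mu>) = 1 \<and>
    (\<forall>n\<ge>1. \<forall>x\<in>level x0 S n. emeasure \<mu> (cylinder x0 S x) = ennreal (cylinder_prob x0 S q x))"

text \<open>Elements of \<open>L\<^sup>0\<close> are represented by measurable functions: \<open>L0_dist\<close> is a pseudometric on
  representatives which, for separable values, vanishes exactly on pairs that agree almost everywhere, and density for it
  is density in the quotient.\<close>

definition L0 :: "'a measure \<Rightarrow> ('a \<Rightarrow> 'e::metric_space) set"
  where "L0 M = borel_measurable M"

definition L0_dist :: "'a measure \<Rightarrow> ('a \<Rightarrow> 'e::metric_space) \<Rightarrow> ('a \<Rightarrow> 'e) \<Rightarrow> real"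
  where "L0_dist M \<psi> \<phi> = (\<integral>e. dist (\<psi> e) (\<phi> e) / (1 + dist (\<psi> e) (\<phi> e)) \<partial>M)"


section \<open>Harmonic and universal functions\<close>

text \<open>The enumeration \<open>z\<close> of the vertices starts at index 0, hence the exponent \<open>Suc n\<close>.\<close>

definition pointwise_dist :: "(nat \<Rightarrow> 'v) \<Rightarrow> ('v \<Rightarrow> 'e::metric_space) \<Rightarrow> ('v \<Rightarrow> 'e) \<Rightarrow> real"
  where "pointwise_dist z f g =
    (\<Sum>n. (1 / 2) ^ Suc n * (dist (f (z n)) (g (z n)) / (1 + dist (f (z n)) (g (z n)))))"

definition harmonic ::
    "('v \<Rightarrow> 'v set) \<Rightarrow> ('v \<Rightarrow> 'v \<Rightarrow> complex) \<Rightarrow> ('v \<Rightarrow> 'e::complex_normed_vector) set"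
  where "harmonic S w = {f. \<forall>x. f x = (\<Sum>y\<in>S x. w x y *\<^sub>C f y)}"

definition level_fun ::
    "'v \<Rightarrow> ('v \<Rightarrow> 'v set) \<Rightarrow> nat \<Rightarrow> ('v \<Rightarrow> 'e) \<Rightarrow> 'v set \<Rightarrow> 'e"
  where "level_fun x0 S n f e = f (THE z. z \<in> e \<inter> level x0 S n)"

definition universal ::
    "'v \<Rightarrow> ('v \<Rightarrow> 'v set) \<Rightarrow> ('v \<Rightarrow> 'v \<Rightarrow> complex) \<Rightarrow> 'v set measure \<Rightarrow>
     ('v \<Rightarrow> 'e::complex_normed_vector) set"
  where "universal x0 S w M =
    {f \<in> harmonic S w. dense_in (L0_dist M) {level_fun x0 S n f | n. n \<ge> 1} (L0 M)}"

end

theory Submission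
  imports Defs
begin

text \<open>Choose in every \<open>S x\<close> a child \<open>s x\<close> with \<open>q x (s x) \<le> 1/2\<close>. A harmonic function may be
  prescribed arbitrarily at the root and at the children outside the range of \<open>s\<close>; its value at
  \<open>s x\<close> is then forced by harmonicity at \<open>x\<close>. If the prescribed values on the \<open>m\<close> levels below
  level \<open>n\<close> are copied from a function \<open>\<phi>\<close> on level \<open>n\<close>, then, as the weights sum to 1, the
  forced values agree with \<open>\<phi>\<close> too, except at the ends of the \<open>m\<close>-step \<open>s\<close>-paths, which carry
  mass at most \<open>2\<^sup>-\<^sup>m\<close>.

  Countably many harmonic functions are built simultaneously: each starts with finitely coded
  values, which makes the family dense, and in the \<open>t\<close>-th block of levels one member is steered to a
  target from a countable dense set of step functions while all the other members
  are steered to 0. A linear combination with a nonzero coefficient at the \<open>j\<close>-th member thereby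
  comes close to every element of \<open>L\<^sup>0\<close>. The zero function is not universal unless \<open>E\<close> is trivial, so
  no such combination vanishes, and splitting the family into two dense halves gives
  \<open>F1\<close> and \<open>F2\<close>.\<close>

section \<open>Complex scalars and the space of harmonic functions\<close>

lemma scaleC_zero_left: "0 *\<^sub>C (x :: 'e::complex_normed_vector) = 0"
  using scaleR_scaleC[of 0 x] by simp

lemma scaleC_zero_right: "c *\<^sub>C (0 :: 'e::complex_normed_vector) = 0"
  using norm_scaleC[of c "0 :: 'e"] by simp

lemma scaleC_minus_left: "(- c) *\<^sub>C x = - (c *\<^sub>C (x :: 'e::complex_normed_vector))"
  using scaleC_add_left[of "- c" c x] by (simp add: scaleC_zero_left eq_neg_iff_add_eq_0)

lemma scaleC_diff_left: "(c - d) *\<^sub>C x = c *\<^sub>C x - d *\<^sub>C (x :: 'e::complex_normed_vector)"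
  using scaleC_add_left[of c "- d" x] by (simp add: scaleC_minus_left)

lemma scaleC_diff_right: "c *\<^sub>C (x - y) = c *\<^sub>C x - c *\<^sub>C (y :: 'e::complex_normed_vector)"
  using scaleC_add_right[of c "x - y" y] by simp

lemma scaleC_sum_right: "c *\<^sub>C (\<Sum>i\<in>A. f i) = (\<Sum>i\<in>A. c *\<^sub>C (f i :: 'e::complex_normed_vector))"
  by (induction A rule: infinite_finite_induct) (simp_all add: scaleC_zero_right scaleC_add_right)

lemma scaleC_sum_left: "(\<Sum>i\<in>A. c i) *\<^sub>C x = (\<Sum>i\<in>A. c i *\<^sub>C (x :: 'e::complex_normed_vector))"
  by (induction A rule: infinite_finite_induct) (simp_all add: scaleC_zero_left scaleC_add_left)

lemma subspace_harmonic:
  "module.subspace scaleC_fun (harmonic S w :: ('v \<Rightarrow> 'e::complex_normed_vector) set)"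
proof -
  interpret vector_space "scaleC_fun :: complex \<Rightarrow> ('v \<Rightarrow> 'e) \<Rightarrow> 'v \<Rightarrow> 'e"
    by (rule vector_space_scaleC_fun)
  show ?thesis
    unfolding subspace_def
  proof (intro conjI ballI allI)
    show "0 \<in> harmonic S w"
      by (simp add: harmonic_def scaleC_zero_right)
  next
    fix f g :: "'v \<Rightarrow> 'e"
    assume "f \<in> harmonic S w" "g \<in> harmonic S w"
    then have eq: "f x = (\<Sum>y\<in>S x. w x y *\<^sub>C f y)" "g x = (\<Sum>y\<in>S x. w x y *\<^sub>C g y)" for x
      unfolding harmonic_def by blast+
    have "(f + g) x = (\<Sum>y\<in>S x. w x y *\<^sub>C (f + g) y)" for x
      unfolding plus_fun_apply scaleC_add_right sum.distrib eq[symmetric] ..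
    then show "f + g \<in> harmonic S w"
      unfolding harmonic_def by blast
  next
    fix c and f :: "'v \<Rightarrow> 'e"
    assume "f \<in> harmonic S w"
    then have eq: "f x = (\<Sum>y\<in>S x. w x y *\<^sub>C f y)" for x
      unfolding harmonic_def by blast
    have "(\<Sum>y\<in>S x. w x y *\<^sub>C scaleC_fun c f y) = c *\<^sub>C (\<Sum>y\<in>S x. w x y *\<^sub>C f y)" for x
      by (simp add: scaleC_fun_def scaleC_sum_right scaleC_scaleC mult.commute)
    then have "scaleC_fun c f x = (\<Sum>y\<in>S x. w x y *\<^sub>C scaleC_fun c f y)" for x
      unfolding eq[symmetric] by (simp add: scaleC_fun_def)
    then show "scaleC_fun c f \<in> harmonic S w"
      unfolding harmonic_def by blast
  qed
qed

lemma sum_scaleC_fun_apply: "(\<Sum>i\<in>A. scaleC_fun (c i) (f i)) x = (\<Sum>i\<in>A. c i *\<^sub>C f i x)"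
  by (induction A rule: infinite_finite_induct) (simp_all add: scaleC_fun_def)

section \<open>Bounds for the two metrics\<close>

text \<open>The weights of the first \<open>k\<close> terms sum to at most 1 and each fraction is at
  most the distance itself; in the remaining terms the fraction is below 1 and the weights sum to
  \<open>(1 / 2) ^ k\<close>.\<close>

lemma pointwise_dist_le:
  assumes "0 \<le> \<delta>" and close: "\<And>n. n < k \<Longrightarrow> dist (f (z n)) (g (z n)) \<le> \<delta>"
  shows "pointwise_dist z f g \<le> \<delta> + (1 / 2) ^ k"
proof -
  let ?d = "\<lambda>n. dist (f (z n)) (g (z n))"
  let ?a = "\<lambda>n. (1 / 2 :: real) ^ Suc n * (?d n / (1 + ?d n))"
  have half: "(\<lambda>n. (1 / 2 :: real) ^ Suc n) sums 1"
    by (rule power_half_series)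
  have le_half: "?a n \<le> (1 / 2) ^ Suc n" and nonneg: "0 \<le> ?a n" for n
    by (auto intro!: mult_left_le simp: divide_le_eq add_pos_nonneg)
  have summable: "summable ?a"
    using le_half nonneg by (intro summable_comparison_test'[OF sums_summable[OF half]]) auto
  have "(\<Sum>n. ?a (n + k)) \<le> (\<Sum>n. (1 / 2) ^ k * (1 / 2) ^ Suc n)"
  proof (rule suminf_le)
    show "?a (n + k) \<le> (1 / 2) ^ k * (1 / 2) ^ Suc n" for n
      using le_half[of "n + k"] by (simp add: power_add mult.commute mult.left_commute)
    show "summable (\<lambda>n. ?a (n + k))"
      by (rule summable_ignore_initial_segment[OF summable])
    show "summable (\<lambda>n. (1 / 2 :: real) ^ k * (1 / 2) ^ Suc n)"
      by (rule summable_mult[OF sums_summable[OF half]])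
  qed
  also have "\<dots> = (1 / 2) ^ k"
    using sums_mult[OF half, of "(1 / 2) ^ k"] by (simp add: sums_iff)
  finally have tail: "(\<Sum>n. ?a (n + k)) \<le> (1 / 2) ^ k" .
  have "(\<Sum>n<k. ?a n) \<le> (\<Sum>n<k. (1 / 2) ^ Suc n * \<delta>)"
  proof (rule sum_mono)
    fix n assume "n \<in> {..<k}"
    have "?d n / (1 + ?d n) \<le> ?d n"
      by (simp add: divide_le_eq add_pos_nonneg algebra_simps)
    also have "\<dots> \<le> \<delta>"
      using close \<open>n \<in> {..<k}\<close> by simp
    finally show "?a n \<le> (1 / 2) ^ Suc n * \<delta>"
      by (intro mult_left_mono) auto
  qed
  also have "\<dots> = (\<Sum>n<k. (1 / 2) ^ Suc n) * \<delta>"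
    by (simp add: sum_distrib_right)
  also have "(\<Sum>n<k. (1 / 2 :: real) ^ Suc n) \<le> 1"
    using sum_le_suminf[OF sums_summable[OF half], of "{..<k}"] sums_unique[OF half] by simp
  then have "(\<Sum>n<k. (1 / 2 :: real) ^ Suc n) * \<delta> \<le> \<delta>"
    using \<open>0 \<le> \<delta>\<close> mult_right_mono by fastforce
  finally show ?thesis
    using suminf_split_initial_segment[OF summable, of k] tail by (simp add: pointwise_dist_def)
qed

text \<open>The integrand is at most \<open>\<delta>\<close> off \<open>X\<close> and at most 1 on
  \<open>X\<close>.\<close>

lemma L0_dist_le:
  assumes "measure M (space M) = 1" and X: "X \<in> sets M" and "0 \<le> \<delta>"
    and close: "\<And>e. e \<in> space M - X \<Longrightarrow> dist (\<psi> e) (\<phi> e) \<le> \<delta>"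
  shows "L0_dist M \<psi> \<phi> \<le> \<delta> + measure M X"
proof -
  \<comment> \<open>\<open>measure\<close> turns infinite mass into 0, so total measure 1 forces
    finiteness.\<close>
  have fin: "finite_measure M"
    using assms(1) by (intro finite_measureI) (auto simp: measure_def top_ereal_def)
  then interpret finite_measure M .
  have int: "integrable M (\<lambda>e. \<delta> + indicator X e :: real)"
    using X by (auto simp: emeasure_finite less_top[symmetric])
  have "dist (\<psi> e) (\<phi> e) / (1 + dist (\<psi> e) (\<phi> e)) \<le> \<delta> + indicator X e" if "e \<in> space M" for e
  proof (cases "e \<in> X")
    case True
    then show ?thesis
      using \<open>0 \<le> \<delta>\<close> by (simp add: divide_le_eq add_pos_nonneg algebra_simps)
  next
    case False
    have "dist (\<psi> e) (\<phi> e) / (1 + dist (\<psi> e) (\<phi> e)) \<le> dist (\<psi> e) (\<phi> e)"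
      by (simp add: divide_le_eq add_pos_nonneg mult_left_le algebra_simps)
    then show ?thesis
      using close[of e] that False by simp
  qed
  then have "L0_dist M \<psi> \<phi> \<le> (\<integral>e. \<delta> + indicator X e \<partial>M)"
    unfolding L0_dist_def using \<open>0 \<le> \<delta>\<close> by (intro integral_mono'[OF int]) auto
  also have "\<dots> = \<delta> + measure M X"
    using X assms(1) by (simp add: emeasure_finite less_top[symmetric])
  finally show ?thesis .
qed

text \<open>Continuity from above: the differences decrease to the empty set.\<close>

lemma (in finite_measure) measure_UN_tail:
  fixes A :: "nat \<Rightarrow> 'a set"
  assumes "\<And>i. A i \<in> sets M" and "\<delta> > 0"
  shows "\<exists>k. measure M ((\<Union>i. A i) - (\<Union>i<k. A i)) < \<delta>"
proof -
  let ?B = "\<lambda>k. (\<Union>i. A i) - (\<Union>i<k. A i)"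
  have "(\<lambda>k. measure M (?B k)) \<longlonglongrightarrow> measure M (\<Inter>k. ?B k)"
  proof (rule finite_Lim_measure_decseq)
    show "range ?B \<subseteq> sets M"
      using assms(1) by auto
    show "decseq ?B"
      unfolding decseq_def by fastforce
  qed
  moreover have "(\<Inter>k. ?B k) = {}"
    by auto
  ultimately have "(\<lambda>k. measure M (?B k)) \<longlonglongrightarrow> 0"
    by (metis measure_empty)
  then have "\<forall>\<^sub>F k in sequentially. measure M (?B k) < \<delta>"
    using assms(2) by (rule order_tendstoD)
  then show ?thesis
    by (auto simp: eventually_sequentially)
qed

section \<open>Countable codes and blocks of levels\<close>

text \<open>The Boolean selects one half of the family, the number is the depth down to which the
  free values are prescribed directly, and the list codes these values.\<close>

type_synonym member_index = "bool \<times> nat \<times> (nat \<times> nat) list"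

text \<open>A task \<open>(j, m, ys, k)\<close> asks to steer member \<open>j\<close> to the step function on level \<open>m\<close> coded by
  \<open>ys\<close>. The number of its block of levels is its code; the component \<open>k\<close> only makes every task recur
  in arbitrarily late blocks.\<close>

type_synonym task = "member_index \<times> nat \<times> (nat \<times> nat) list \<times> nat"

definition dense_sequence :: "(nat \<Rightarrow> 'e::metric_space) \<Rightarrow> bool"
  where "dense_sequence D \<longleftrightarrow> (\<forall>x. \<forall>\<epsilon>>0. \<exists>i. dist x (D i) < \<epsilon>)"

text \<open>An association list from vertex numbers to positions in \<open>D\<close> is used because
  such lists form a countable type, so that a code can enter a block number. Vertices missing from
  the list receive 0.\<close>

definition decode :: "(nat \<Rightarrow> 'e::zero) \<Rightarrow> (nat \<Rightarrow> 'v) \<Rightarrow> (nat \<times> nat) list \<Rightarrow> 'v \<Rightarrow> 'e"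
  where "decode D z xs v = (case map_of xs (inv z v) of None \<Rightarrow> 0 | Some i \<Rightarrow> D i)"

text \<open>Only finitely many vertices have to be matched, so one position in \<open>D\<close> per
  vertex can be listed.\<close>

lemma decode_approx:
  assumes D: "dense_sequence D" and "bij z" "finite A" "\<epsilon> > 0"
  shows "\<exists>xs. \<forall>v\<in>A. dist (p v) (decode D z xs v) < \<epsilon>"
proof -
  have "\<forall>v. \<exists>i. dist (p v) (D i) < \<epsilon>"
    using D \<open>\<epsilon> > 0\<close> by (simp add: dense_sequence_def)
  from choice[OF this] obtain i where i: "\<And>v. dist (p v) (D (i v)) < \<epsilon>"
    by blast
  obtain ks where ks: "set ks = inv z ` A"
    using finite_list[of "inv z ` A"] \<open>finite A\<close> by auto
  have "decode D z (map (\<lambda>k. (k, i (z k))) ks) v = D (i v)" if "v \<in> A" for v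
    using that ks \<open>bij z\<close> by (simp add: decode_def map_of_map_restrict bij_is_surj surj_f_inv_f)
  then show ?thesis
    using i by metis
qed

text \<open>Block \<open>t\<close> consists of the levels \<open>l\<close> with
  \<open>2 ^ t < l\<close> and \<open>l \<le> 2 ^ Suc t\<close>, so its length \<open>2 ^ t\<close>
  grows with \<open>t\<close>; levels 0 and 1 are added to block 0.\<close>

definition block :: "nat \<Rightarrow> nat"
  where "block l = (LEAST t. l \<le> 2 ^ Suc t)"

lemma block_eq:
  assumes "2 ^ t < l" "l \<le> 2 ^ Suc t"
  shows "block l = t"
  unfolding block_def
proof (rule Least_equality)
  show "l \<le> 2 ^ Suc t"
    by (rule assms(2))
next
  fix u assume "l \<le> 2 ^ Suc u"
  with assms(1) have "(2::nat) ^ t < 2 ^ Suc u"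
    by linarith
  then show "t \<le> u"
    using power_less_imp_less_exp[of "2 :: nat" t "Suc u"] by simp
qed

section \<open>Paths, ancestors and boundary points of the tree\<close>

locale tree =
  fixes x0 :: 'v and S :: "'v \<Rightarrow> 'v set"
  assumes unique_root_path: "rooted_tree x0 S"
begin

definition geodesic :: "'v \<Rightarrow> 'v list"
  where "geodesic v = (THE ys. root_path x0 S v ys)"

definition depth :: "'v \<Rightarrow> nat"
  where "depth v = length (geodesic v) - 1"

definition parent :: "'v \<Rightarrow> 'v"
  where "parent v = last (butlast (geodesic v))"

text \<open>Intended for \<open>n \<le> depth v\<close>; for larger \<open>n\<close> the truncated
  subtraction makes the value \<open>v\<close> itself.\<close>

definition ancestor :: "nat \<Rightarrow> 'v \<Rightarrow> 'v"
  where "ancestor n v = (parent ^^ (depth v - n)) v"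

definition vertex :: "nat \<Rightarrow> 'v set \<Rightarrow> 'v"
  where "vertex n e = (THE v. v \<in> e \<inter> level x0 S n)"

lemma root_path_geodesic: "root_path x0 S v (geodesic v)"
  using unique_root_path unfolding geodesic_def rooted_tree_def by (metis (mono_tags, lifting) theI_unique)

lemma geodesic_unique: "root_path x0 S v ys \<Longrightarrow> geodesic v = ys"
  using unique_root_path root_path_geodesic unfolding rooted_tree_def by metis

lemma length_geodesic: "length (geodesic v) = Suc (depth v)"
  using root_path_geodesic[of v] unfolding depth_def root_path_def by (cases "geodesic v") auto

lemma geodesic_child:
  assumes "y \<in> S x"
  shows "geodesic y = geodesic x @ [y]"
  using root_path_geodesic[of x] assms
  by (intro geodesic_unique) (auto simp: root_path_def successively_append_iff)

lemma level_eq: "level x0 S n = {v. depth v = n}"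
  unfolding level_def using geodesic_unique root_path_geodesic length_geodesic by fastforce

lemma depth_child: "y \<in> S x \<Longrightarrow> depth y = Suc (depth x)"
  using length_geodesic[of x] length_geodesic[of y] by (simp add: geodesic_child)

lemma parent_child: "y \<in> S x \<Longrightarrow> parent y = x"
  using root_path_geodesic[of x] by (simp add: parent_def geodesic_child root_path_def)

lemma depth_root: "depth x0 = 0"
proof -
  have "geodesic x0 = [x0]"
    by (rule geodesic_unique) (simp add: root_path_def)
  then show ?thesis
    by (simp add: depth_def)
qed

lemma depth_eq_0_iff: "depth v = 0 \<longleftrightarrow> v = x0"
proof
  assume "depth v = 0"
  then show "v = x0"
    using root_path_geodesic[of v] length_geodesic[of v]
    by (cases "geodesic v") (auto simp: root_path_def)
qed (simp add: depth_root)

lemma root_not_child: "x0 \<notin> S x"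
  using depth_child depth_root by fastforce

lemma child_parent:
  assumes "v \<noteq> x0"
  shows "v \<in> S (parent v)"
proof -
  define ys where "ys = butlast (geodesic v)"
  have path: "geodesic v = ys @ [v]"
    using root_path_geodesic[of v] unfolding ys_def root_path_def by (metis append_butlast_last_id)
  have "ys \<noteq> []"
    using root_path_geodesic[of v] path assms by (auto simp: root_path_def)
  then show ?thesis
    using root_path_geodesic[of v] path
    by (auto simp: root_path_def successively_append_iff parent_def)
qed

lemma depth_parent: "v \<noteq> x0 \<Longrightarrow> depth v = Suc (depth (parent v))"
  using child_parent depth_child by blast

lemma tree_induct [case_names root child]:
  assumes "P x0" and "\<And>x y. P x \<Longrightarrow> y \<in> S x \<Longrightarrow> P y"
  shows "P v"
proof (induction "depth v" arbitrary: v)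
  case 0
  then show ?case
    using assms(1) depth_eq_0_iff by metis
next
  case (Suc n)
  then have "v \<noteq> x0"
    using depth_root by force
  then show ?case
    using Suc depth_parent child_parent assms(2) by (metis Suc_inject)
qed

lemma ancestor_depth: "depth v = n \<Longrightarrow> ancestor n v = v"
  by (simp add: ancestor_def)

lemma ancestor_child: "y \<in> S x \<Longrightarrow> n \<le> depth x \<Longrightarrow> ancestor n y = ancestor n x"
  by (simp add: ancestor_def depth_child Suc_diff_le funpow_swap1[symmetric] parent_child
      del: funpow.simps(2)) (metis funpow_swap1 parent_child funpow.simps(2) comp_apply)

text \<open>Depth grows by one along the sequence, so its \<open>n\<close>-th entry is the only
  element of \<open>e\<close> on level \<open>n\<close>; this evaluates the description in
  \<open>vertex\<close>.\<close>

lemma boundaryE: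
  assumes "e \<in> boundary x0 S"
  obtains v where "\<And>n. v n \<in> e" "e = range v" "v 0 = x0" "\<And>n. v (Suc n) \<in> S (v n)"
    "\<And>n. vertex n e = v n" "\<And>n. depth (v n) = n"
proof -
  obtain v where v: "e = range v" "v 0 = x0" "\<And>n. v (Suc n) \<in> S (v n)"
    using assms unfolding boundary_def by blast
  have depth: "depth (v n) = n" for n
    by (induction n) (simp_all add: v depth_root depth_child[OF v(3)])
  have "vertex n e = v n" for n
    unfolding vertex_def using depth by (intro the_equality) (auto simp: level_eq v)
  then show thesis
    by (intro that[of v]) (use v depth in auto)
qed

lemma depth_vertex: "e \<in> boundary x0 S \<Longrightarrow> depth (vertex n e) = n"
  by (metis boundaryE)

lemma mem_boundary_iff: "e \<in> boundary x0 S \<Longrightarrow> x \<in> e \<longleftrightarrow> vertex (depth x) e = x"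
  by (erule boundaryE) (metis rangeE)

lemma cylinder_eq: "cylinder x0 S x = {e \<in> boundary x0 S. vertex (depth x) e = x}"
  using mem_boundary_iff by (auto simp: cylinder_def)

lemma ancestor_vertex:
  assumes "e \<in> boundary x0 S" "m \<le> n"
  shows "ancestor m (vertex n e) = vertex m e"
proof -
  obtain v where v: "\<And>n. v (Suc n) \<in> S (v n)" "\<And>n. vertex n e = v n" "\<And>n. depth (v n) = n"
    using assms(1) by (metis boundaryE)
  have "ancestor m (v n) = v m"
    using assms(2) by (induction rule: dec_induct) (simp_all add: ancestor_depth v ancestor_child[OF v(1)])
  then show ?thesis
    by (simp add: v)
qed

lemma level_fun_eq: "level_fun x0 S n f e = f (vertex n e)"
  by (simp add: level_fun_def vertex_def)

text \<open>The geodesic to \<open>y\<close> is the geodesic to \<open>x\<close> with one more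
  edge.\<close>

lemma cylinder_prob_child:
  assumes "y \<in> S x"
  shows "cylinder_prob x0 S q y = cylinder_prob x0 S q x * q x y"
proof -
  have last: "geodesic x ! depth x = x"
    using root_path_geodesic[of x] length_geodesic[of x] by (metis root_path_def last_conv_nth diff_Suc_1)
  have eq: "cylinder_prob x0 S q v = (\<Prod>j<depth v. q (geodesic v ! j) (geodesic v ! Suc j))" for v
    by (simp add: cylinder_prob_def geodesic_def[symmetric] Let_def length_geodesic)
  show ?thesis
    unfolding eq depth_child[OF assms] geodesic_child[OF assms] prod.lessThan_Suc
    by (intro arg_cong2[where f = "(*)"] prod.cong refl)
      (auto simp: nth_append length_geodesic last)
qed

lemma ancestor_ancestor:
  assumes "m \<le> n" "n \<le> depth v"
  shows "ancestor m (ancestor n v) = ancestor m v"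
proof -
  \<comment> \<open>This shows that \<open>ancestor n v\<close> lies on level \<open>n\<close>,
    after which the two iterates of \<open>parent\<close> can be added up.\<close>
  have "depth ((parent ^^ k) v) = depth v - k" if "k \<le> depth v" for k
    using that
  proof (induction k)
    case (Suc k)
    then have "depth ((parent ^^ k) v) = depth v - k" "(parent ^^ k) v \<noteq> x0"
      using depth_root by fastforce+
    then show ?case
      using depth_parent by fastforce
  qed simp
  then have "depth (ancestor n v) = n"
    using assms(2) by (simp add: ancestor_def)
  then have "ancestor m (ancestor n v) = (parent ^^ ((n - m) + (depth v - n))) v"
    by (simp add: ancestor_def funpow_add)
  then show ?thesis
    using assms by (simp add: ancestor_def)
qed

end

section \<open>Harmonic extension of free values\<close>

locale harmonic_tree = tree x0 S
  for x0 :: 'v and S :: "'v \<Rightarrow> 'v set" +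
  fixes w :: "'v \<Rightarrow> 'v \<Rightarrow> complex" and s :: "'v \<Rightarrow> 'v"
  assumes finite_children: "finite (S x)"
    and weight_nonzero: "y \<in> S x \<Longrightarrow> w x y \<noteq> 0"
    and weight_sum: "(\<Sum>y\<in>S x. w x y) = 1"
    and s_child: "s x \<in> S x"
begin

text \<open>The numerical argument is meant to be the depth. The siblings of
  \<open>s (parent v)\<close> are free and carry \<open>g\<close> itself, so the recursion only has
  to visit the parent.\<close>

primrec ext_aux :: "('v \<Rightarrow> 'e::complex_normed_vector) \<Rightarrow> nat \<Rightarrow> 'v \<Rightarrow> 'e" where
  "ext_aux g 0 v = g v"
| "ext_aux g (Suc n) v =
    (if v \<noteq> s (parent v) then g v
     else inverse (w (parent v) v) *\<^sub>C
       (ext_aux g n (parent v) - (\<Sum>y\<in>S (parent v) - {v}. w (parent v) y *\<^sub>C g y)))"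

definition harmonic_ext :: "('v \<Rightarrow> 'e::complex_normed_vector) \<Rightarrow> 'v \<Rightarrow> 'e"
  where "harmonic_ext g v = ext_aux g (depth v) v"

lemma harmonic_ext_root: "harmonic_ext g x0 = g x0"
  by (simp add: harmonic_ext_def depth_root)

lemma harmonic_ext_free: "y \<in> S x \<Longrightarrow> y \<noteq> s x \<Longrightarrow> harmonic_ext g y = g y"
  by (simp add: harmonic_ext_def depth_child parent_child)

lemma harmonic_ext_s:
  "harmonic_ext g (s x) = inverse (w x (s x)) *\<^sub>C
     (harmonic_ext g x - (\<Sum>y\<in>S x - {s x}. w x y *\<^sub>C g y))"
  using s_child[of x] by (simp add: harmonic_ext_def depth_child parent_child)

lemma harmonic_harmonic_ext: "harmonic_ext g \<in> harmonic S w"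
proof -
  have "harmonic_ext g x = (\<Sum>y\<in>S x. w x y *\<^sub>C harmonic_ext g y)" for x
  proof -
    have "(\<Sum>y\<in>S x. w x y *\<^sub>C harmonic_ext g y) =
        w x (s x) *\<^sub>C harmonic_ext g (s x) + (\<Sum>y\<in>S x - {s x}. w x y *\<^sub>C harmonic_ext g y)"
      by (intro sum.remove finite_children s_child)
    also have "(\<Sum>y\<in>S x - {s x}. w x y *\<^sub>C harmonic_ext g y) = (\<Sum>y\<in>S x - {s x}. w x y *\<^sub>C g y)"
      by (intro sum.cong) (auto simp: harmonic_ext_free)
    also have "w x (s x) *\<^sub>C harmonic_ext g (s x) =
        harmonic_ext g x - (\<Sum>y\<in>S x - {s x}. w x y *\<^sub>C g y)"
      using weight_nonzero[OF s_child] by (simp add: harmonic_ext_s scaleC_scaleC scaleC_one)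
    finally show ?thesis
      by simp
  qed
  then show ?thesis
    unfolding harmonic_def by blast
qed

text \<open>Induction on \<open>m\<close>. A free child has the target value by assumption. If
  \<open>x = s y\<close> and \<open>y\<close> already has the target value \<open>a\<close>, the
  siblings contribute \<open>(1 - w y x) *\<^sub>C a\<close>, and the equation at \<open>y\<close>
  leaves \<open>a\<close> for \<open>x\<close>. Hence a wrong value can only travel along the
  \<open>s\<close>-path that starts on level \<open>n\<close>.\<close>

lemma harmonic_ext_eq_target:
  assumes "\<And>y. n < depth y \<Longrightarrow> depth y \<le> n + m \<Longrightarrow> g y = \<phi> (ancestor n y)"
    and "depth x = n + m" and "x \<noteq> (s ^^ m) (ancestor n x)"
  shows "harmonic_ext g x = \<phi> (ancestor n x)"
  using assms
proof (induction m arbitrary: x)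
  \<comment> \<open>For \<open>m = 0\<close> the vertex is its own ancestor, so the premise
    excluding the \<open>s\<close>-path is contradictory.\<close>
  case 0
  then show ?case
    by (simp add: ancestor_depth)
next
  case (Suc m)
  define y where "y = parent x"
  have "x \<noteq> x0"
    using Suc.prems(2) depth_root by force
  then have x: "x \<in> S y"
    using child_parent y_def by simp
  then have y: "depth y = n + m"
    using Suc.prems(2) depth_child by simp
  have anc: "ancestor n z = ancestor n x" if "z \<in> S y" for z
    using that x y ancestor_child by simp
  have g: "g z = \<phi> (ancestor n x)" if "z \<in> S y" for z
    using Suc.prems(1)[of z] that anc[OF that] y by (simp add: depth_child)
  have anc_y: "ancestor n y = ancestor n x"
    using x y ancestor_child by simp
  show ?case
  proof (cases "x = s y")
    case False
    then show ?thesis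
      using x g harmonic_ext_free by metis
  next
    case True
    then have "y \<noteq> (s ^^ m) (ancestor n y)"
      using Suc.prems(3) anc_y by auto
    then have "harmonic_ext g y = \<phi> (ancestor n x)"
      using Suc.IH[of y] Suc.prems(1) y anc_y by simp
    moreover have "(\<Sum>z\<in>S y - {x}. w y z *\<^sub>C g z) = (1 - w y x) *\<^sub>C \<phi> (ancestor n x)"
    proof -
      have "1 - w y x = (\<Sum>z\<in>S y - {x}. w y z)"
        using weight_sum[of y] finite_children[of y] x by (simp add: sum.remove algebra_simps)
      then show ?thesis
        by (simp add: scaleC_sum_left g)
    qed
    ultimately have "harmonic_ext g x =
        inverse (w y x) *\<^sub>C (\<phi> (ancestor n x) - (1 - w y x) *\<^sub>C \<phi> (ancestor n x))"
      using True by (simp add: harmonic_ext_s)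
    also have "\<phi> (ancestor n x) - (1 - w y x) *\<^sub>C \<phi> (ancestor n x) = w y x *\<^sub>C \<phi> (ancestor n x)"
      using scaleC_diff_left[of 1 "1 - w y x" "\<phi> (ancestor n x)"] by (simp add: scaleC_one)
    finally show ?thesis
      using weight_nonzero[OF x] by (simp add: scaleC_scaleC scaleC_one)
  qed
qed

text \<open>The formula of \<open>harmonic_ext_s\<close> for an arbitrary harmonic function; it is
  applied to differences.\<close>

lemma harmonic_s:
  assumes "u \<in> harmonic S w"
  shows "u (s x) = inverse (w x (s x)) *\<^sub>C (u x - (\<Sum>y\<in>S x - {s x}. w x y *\<^sub>C u y))"
proof -
  have "u x = (\<Sum>y\<in>S x. w x y *\<^sub>C u y)"
    using assms unfolding harmonic_def by blast
  also have "\<dots> = w x (s x) *\<^sub>C u (s x) + (\<Sum>y\<in>S x - {s x}. w x y *\<^sub>C u y)"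
    by (intro sum.remove finite_children s_child)
  finally have "u x - (\<Sum>y\<in>S x - {s x}. w x y *\<^sub>C u y) = w x (s x) *\<^sub>C u (s x)"
    by (metis add_diff_cancel_right')
  then show ?thesis
    using weight_nonzero[OF s_child] by (simp add: scaleC_scaleC scaleC_one)
qed

text \<open>Going down the tree, a forced value is a fixed combination of the value at the parent
  and the free values at the siblings. The constant depends on \<open>v\<close> alone, so closeness
  at the free vertices carries over to any finite set of vertices.\<close>

lemma harmonic_bound:
  "\<exists>C>0. \<forall>u\<in>harmonic S w. \<forall>\<delta>.
     (\<forall>y. y \<notin> range s \<longrightarrow> depth y \<le> depth v \<longrightarrow> norm (u y :: 'e::complex_normed_vector) \<le> \<delta>) \<longrightarrow>
     norm (u v) \<le> C * \<delta>"
proof (induction v rule: tree_induct)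
  case root
  have "x0 \<notin> range s"
    using root_not_child s_child by (metis imageE)
  then show ?case
    by (intro exI[of _ 1]) simp
next
  case (child x v)
  obtain C where C: "C > 0" "\<And>u \<delta>. u \<in> harmonic S w \<Longrightarrow>
      (\<And>y. y \<notin> range s \<Longrightarrow> depth y \<le> depth x \<Longrightarrow> norm (u y :: 'e) \<le> \<delta>) \<Longrightarrow> norm (u x) \<le> C * \<delta>"
    using child(1) by meson
  show ?case
  proof (cases "v = s x")
    case False
    then have "v \<notin> range s"
      using child(2) parent_child s_child by (metis imageE)
    then show ?thesis
      by (intro exI[of _ 1]) simp
  next
    case True
    \<comment> \<open>Solving the equation at \<open>x\<close> for the value at \<open>v\<close>
      divides by \<open>w x v\<close>; the parent contributes \<open>C\<close> and the siblings
      contribute \<open>B\<close>.\<close>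
    define B where "B = (\<Sum>y\<in>S x - {v}. cmod (w x y))"
    define C' where "C' = cmod (inverse (w x v)) * (C + B)"
    have "B \<ge> 0"
      unfolding B_def by (intro sum_nonneg) simp
    then have "C' > 0"
      using C(1) weight_nonzero[OF child(2)] by (simp add: C'_def)
    moreover have "norm (u v) \<le> C' * \<delta>" if u: "u \<in> harmonic S w"
      and small: "\<And>y. y \<notin> range s \<Longrightarrow> depth y \<le> depth v \<Longrightarrow> norm (u y :: 'e) \<le> \<delta>" for u \<delta>
    proof -
      have x: "norm (u x) \<le> C * \<delta>"
        using C(2)[OF u] small depth_child[OF child(2)] by simp
      have "norm (\<Sum>y\<in>S x - {v}. w x y *\<^sub>C u y) \<le> (\<Sum>y\<in>S x - {v}. cmod (w x y) * \<delta>)"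
      proof (rule sum_norm_le)
        fix y assume y: "y \<in> S x - {v}"
        then have "y \<notin> range s"
          using parent_child s_child True by (metis DiffE imageE insertI1)
        then have "norm (u y) \<le> \<delta>"
          using y child(2) depth_child[of _ x] small by simp
        then show "norm (w x y *\<^sub>C u y) \<le> cmod (w x y) * \<delta>"
          by (simp add: norm_scaleC mult_left_mono)
      qed
      then have "norm (\<Sum>y\<in>S x - {v}. w x y *\<^sub>C u y) \<le> B * \<delta>"
        by (simp add: B_def sum_distrib_right)
      then have "norm (u x - (\<Sum>y\<in>S x - {v}. w x y *\<^sub>C u y)) \<le> (C + B) * \<delta>"
        using x norm_triangle_ineq4[of "u x" "\<Sum>y\<in>S x - {v}. w x y *\<^sub>C u y"]
        by (simp add: algebra_simps)
      then show ?thesis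
        unfolding True harmonic_s[OF u, of x] C'_def norm_scaleC mult.assoc
        by (intro mult_left_mono) (simp_all add: True)
    qed
    ultimately show ?thesis
      by blast
  qed
qed

lemma harmonic_ext_not_s: "y \<notin> range s \<Longrightarrow> harmonic_ext g y = g y"
  using harmonic_ext_root harmonic_ext_free child_parent by (metis rangeI)

section \<open>The countable family\<close>

text \<open>Below the initial depth \<open>n\<close> the block number is read as a task; the member
  copies the step function of level \<open>m\<close> downwards if the task names it and is steered
  to 0 otherwise.\<close>

definition free_values ::
    "(nat \<Rightarrow> 'e::complex_normed_vector) \<Rightarrow> (nat \<Rightarrow> 'v) \<Rightarrow> member_index \<Rightarrow> 'v \<Rightarrow> 'e"
  where "free_values D z i y = (case i of (b, n, xs) \<Rightarrow>
    if depth y \<le> n then decode D z xs y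
    else case (from_nat (block (depth y)) :: task) of
      (j, m, ys, k) \<Rightarrow> if j = i then decode D z ys (ancestor m y) else 0)"

definition "family" ::
    "(nat \<Rightarrow> 'e::complex_normed_vector) \<Rightarrow> (nat \<Rightarrow> 'v) \<Rightarrow> member_index \<Rightarrow> 'v \<Rightarrow> 'e"
  where "family D z i = harmonic_ext (free_values D z i)"

text \<open>Block \<open>t\<close> runs from just below level \<open>2 ^ t\<close> to level
  \<open>2 ^ Suc t\<close>, so \<open>harmonic_ext_eq_target\<close> applies with both parameters
  equal to \<open>2 ^ t\<close>. The bound on \<open>fst (snd i)\<close> keeps the initial values of
  member \<open>i\<close> out of the block.\<close>

lemma family_eq_target:
  assumes t: "t = to_nat ((j, m, ys, k) :: task)"
    and "m \<le> 2 ^ t" "fst (snd i) \<le> 2 ^ t"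
    and x: "depth x = 2 ^ Suc t" "x \<noteq> (s ^^ (2 ^ t)) (ancestor (2 ^ t) x)"
  shows "family D z i x = (if i = j then decode D z ys (ancestor m x) else 0)"
proof -
  \<comment> \<open>Steering to the step function and steering to 0 are both given by one target on
    level \<open>2 ^ t\<close>.\<close>
  let ?\<phi> = "\<lambda>v. if i = j then decode D z ys (ancestor m v) else 0"
  have "free_values D z i y = ?\<phi> (ancestor (2 ^ t) y)"
    if "2 ^ t < depth y" "depth y \<le> 2 ^ t + 2 ^ t" for y
  proof -
    have "block (depth y) = t"
      using that by (intro block_eq) auto
    moreover have "\<not> depth y \<le> fst (snd i)"
      using that assms(3) by simp
    ultimately show ?thesis
      using that assms(2) by (auto simp: free_values_def t ancestor_ancestor split: prod.split)
  qed
  then have "harmonic_ext (free_values D z i) x = ?\<phi> (ancestor (2 ^ t) x)"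
    using x by (intro harmonic_ext_eq_target[where m = "2 ^ t"]) auto
  then show ?thesis
    using assms(2) x(1) by (simp add: family_def ancestor_ancestor)
qed

end

section \<open>Cylinder measures and exceptional sets\<close>

locale boundary_measure = harmonic_tree x0 S w s
  for x0 :: 'v and S :: "'v \<Rightarrow> 'v set" and w :: "'v \<Rightarrow> 'v \<Rightarrow> complex" and s :: "'v \<Rightarrow> 'v" +
  fixes q :: "'v \<Rightarrow> 'v \<Rightarrow> real" and \<mu> :: "'v set measure"
  assumes finite_level: "finite (level x0 S n)"
    and q_pos: "y \<in> S x \<Longrightarrow> q x y > 0"
    and q_s: "q x (s x) \<le> 1 / 2"
    and extension: "kolmogorov_extension x0 S q \<mu>"
begin

lemma space_mu: "space \<mu> = boundary x0 S"
  using extension by (simp add: kolmogorov_extension_def)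

lemma emeasure_space_mu: "emeasure \<mu> (space \<mu>) = 1"
  using extension unfolding kolmogorov_extension_def by blast

lemma measure_space_mu: "measure \<mu> (space \<mu>) = 1"
  unfolding measure_def emeasure_space_mu by simp

sublocale finite_measure \<mu>
  by (intro finite_measureI) (unfold emeasure_space_mu, simp)

lemma cylinder_prob_nonneg: "0 \<le> cylinder_prob x0 S q v"
proof (induction v rule: tree_induct)
  case root
  have "geodesic x0 = [x0]"
    by (rule geodesic_unique) (simp add: root_path_def)
  then show ?case
    by (simp add: cylinder_prob_def geodesic_def[symmetric])
next
  case (child x y)
  then show ?case
    using q_pos[of y x] by (simp add: cylinder_prob_child)
qed

lemma measure_cylinder: "depth v \<ge> 1 \<Longrightarrow> measure \<mu> (cylinder x0 S v) = cylinder_prob x0 S q v"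
  using extension cylinder_prob_nonneg[of v]
  by (simp add: kolmogorov_extension_def measure_def level_eq)

text \<open>A single generating family of cylinders is the form needed for
  \<open>sigma_sets.induct\<close>.\<close>

lemma sets_mu: "sets \<mu> = sigma_sets (boundary x0 S) (cylinder x0 S ` {v. depth v \<ge> 1})"
proof -
  let ?C = "cylinder x0 S ` {v. depth v \<ge> 1}"
  have "sigma_sets (boundary x0 S) (\<Union>n\<in>{1..}. level_algebra x0 S n) = sigma_sets (boundary x0 S) ?C"
  proof (rule sigma_sets_eqI)
    fix A assume "A \<in> (\<Union>n\<in>{1..}. level_algebra x0 S n)"
    then obtain n where "n \<ge> 1" "A \<in> sigma_sets (boundary x0 S) (cylinder x0 S ` level x0 S n)"
      by (auto simp: level_algebra_def)
    moreover have "cylinder x0 S ` level x0 S n \<subseteq> ?C" if "n \<ge> 1" for n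
      using that by (auto simp: level_eq)
    ultimately show "A \<in> sigma_sets (boundary x0 S) ?C"
      using sigma_sets_mono' by blast
  next
    fix A assume "A \<in> ?C"
    then obtain v where "A = cylinder x0 S v" "depth v \<ge> 1"
      by blast
    then show "A \<in> sigma_sets (boundary x0 S) (\<Union>n\<in>{1..}. level_algebra x0 S n)"
      by (intro sigma_sets.Basic UN_I[of "depth v"])
        (auto simp: level_algebra_def level_eq intro: sigma_sets.Basic)
  qed
  then show ?thesis
    using extension by (simp add: kolmogorov_extension_def)
qed

lemma cylinder_in_sets: "depth v \<ge> 1 \<Longrightarrow> cylinder x0 S v \<in> sets \<mu>"
  unfolding sets_mu by (rule sigma_sets.Basic) simp

lemma vertex_preimage_in_sets:
  assumes "n \<ge> 1"
  shows "{e \<in> boundary x0 S. vertex n e \<in> V} \<in> sets \<mu>"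
proof -
  have "{e \<in> boundary x0 S. vertex n e \<in> V} = (\<Union>v\<in>level x0 S n \<inter> V. cylinder x0 S v)"
    by (auto simp: cylinder_eq level_eq depth_vertex)
  also have "\<dots> \<in> sets \<mu>"
    using assms finite_level by (intro sets.finite_UN cylinder_in_sets) (auto simp: level_eq)
  finally show ?thesis .
qed

lemma depth_funpow_s: "depth ((s ^^ m) v) = depth v + m"
  by (induction m) (simp_all add: depth_child[OF s_child])

text \<open>Each step along \<open>s\<close> multiplies the probability by at most 1/2, by
  \<open>q_s\<close>.\<close>

lemma cylinder_prob_funpow_s:
  "cylinder_prob x0 S q ((s ^^ m) v) \<le> (1 / 2) ^ m * cylinder_prob x0 S q v"
proof (induction m)
  case (Suc m)
  have "cylinder_prob x0 S q ((s ^^ Suc m) v) \<le> cylinder_prob x0 S q ((s ^^ m) v) * (1 / 2)"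
    using q_s cylinder_prob_nonneg
    by (simp add: cylinder_prob_child[OF s_child] mult_left_mono del: times_divide_eq_right)
  with Suc show ?case
    by simp
qed simp

text \<open>The cylinders of one level partition the boundary.\<close>

lemma sum_cylinder_prob:
  assumes "n \<ge> 1"
  shows "(\<Sum>v\<in>level x0 S n. cylinder_prob x0 S q v) = 1"
proof -
  have "(\<Sum>v\<in>level x0 S n. cylinder_prob x0 S q v) = (\<Sum>v\<in>level x0 S n. measure \<mu> (cylinder x0 S v))"
    using assms by (intro sum.cong) (auto simp: measure_cylinder level_eq)
  also have "\<dots> = measure \<mu> (\<Union>v\<in>level x0 S n. cylinder x0 S v)"
    using assms finite_level cylinder_in_sets
    by (intro finite_measure_finite_Union[symmetric])
      (auto simp: level_eq disjoint_family_on_def cylinder_eq)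
  also have "(\<Union>v\<in>level x0 S n. cylinder x0 S v) = space \<mu>"
    by (auto simp: space_mu cylinder_eq level_eq depth_vertex)
  finally show ?thesis
    by (simp add: measure_space_mu)
qed

text \<open>These are the boundary points that follow \<open>s\<close> for all steps from level
  \<open>n\<close> to level \<open>n + m\<close>, the only ones at which copying over
  \<open>m\<close> levels may fail.\<close>

definition exceptional :: "nat \<Rightarrow> nat \<Rightarrow> 'v set set"
  where "exceptional n m = {e \<in> boundary x0 S. vertex (n + m) e = (s ^^ m) (vertex n e)}"

lemma exceptional_eq: "exceptional n m = (\<Union>v\<in>level x0 S n. cylinder x0 S ((s ^^ m) v))"
proof -
  \<comment> \<open>The end of an \<open>s\<close>-path determines its starting vertex on level
    \<open>n\<close>, so the equation in \<open>exceptional\<close> can be split according to that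
    vertex.\<close>
  have "ancestor n ((s ^^ m) v) = v" if "depth v = n" for v
    using that by (induction m) (simp_all add: ancestor_depth ancestor_child[OF s_child] depth_funpow_s)
  then have "vertex n e = v" if "depth v = n" "e \<in> boundary x0 S" "vertex (n + m) e = (s ^^ m) v" for e v
    using that ancestor_vertex[of e n "n + m"] by simp
  moreover have "\<exists>v. depth v = n \<and> (s ^^ m) (vertex n e) = (s ^^ m) v" if "e \<in> boundary x0 S" for e
    using depth_vertex[OF that] by blast
  ultimately show ?thesis
    by (auto simp: exceptional_def cylinder_eq level_eq depth_funpow_s)
qed

lemma exceptional_in_sets: "n \<ge> 1 \<Longrightarrow> exceptional n m \<in> sets \<mu>"
  unfolding exceptional_eq
  using finite_level by (intro sets.finite_UN cylinder_in_sets) (auto simp: level_eq depth_funpow_s)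

text \<open>Every cylinder of level \<open>n\<close> contributes at most \<open>(1 / 2) ^ m\<close>
  times its own mass, and these masses sum to 1.\<close>

lemma measure_exceptional:
  assumes "n \<ge> 1"
  shows "measure \<mu> (exceptional n m) \<le> (1 / 2) ^ m"
proof -
  have "measure \<mu> (exceptional n m) \<le> (\<Sum>v\<in>level x0 S n. measure \<mu> (cylinder x0 S ((s ^^ m) v)))"
    unfolding exceptional_eq using assms finite_level cylinder_in_sets
    by (intro finite_measure_subadditive_finite) (auto simp: level_eq depth_funpow_s)
  also have "\<dots> = (\<Sum>v\<in>level x0 S n. cylinder_prob x0 S q ((s ^^ m) v))"
    using assms by (intro sum.cong) (auto simp: measure_cylinder level_eq depth_funpow_s)
  also have "\<dots> \<le> (\<Sum>v\<in>level x0 S n. (1 / 2) ^ m * cylinder_prob x0 S q v)"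
    by (intro sum_mono cylinder_prob_funpow_s)
  also have "\<dots> = (1 / 2) ^ m"
    using sum_cylinder_prob[OF assms] by (simp add: sum_distrib_left[symmetric])
  finally show ?thesis .
qed

section \<open>Approximation of measurable sets and functions by levels\<close>

text \<open>Off a set of small measure, membership is decided by the vertex on a single level. The
  small set is taken from \<open>\<mu>\<close> also when \<open>A\<close> is only measurable for the
  completion.\<close>

definition approximable :: "'v set set \<Rightarrow> bool"
  where "approximable A \<longleftrightarrow> (\<forall>\<delta>>0. \<exists>m\<ge>1. \<exists>V. \<exists>X\<in>sets \<mu>. measure \<mu> X < \<delta> \<and>
    (\<forall>e\<in>boundary x0 S - X. e \<in> A \<longleftrightarrow> vertex m e \<in> V))"

text \<open>Finitely many sets can share one level: a condition on a shallower level is read off the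
  maximal one through \<open>ancestor\<close>.\<close>

lemma approximable_family:
  assumes "\<And>i::nat. approximable (A i)" and "\<delta> > 0"
  shows "\<exists>m\<ge>1. \<exists>V. \<exists>X\<in>sets \<mu>. measure \<mu> X < \<delta> \<and>
    (\<forall>i<k. \<forall>e\<in>boundary x0 S - X. e \<in> A i \<longleftrightarrow> vertex m e \<in> V i)"
  using assms(2)
proof (induction k arbitrary: \<delta>)
  case 0
  then show ?case
    by (intro exI[of _ 1] conjI exI[of _ "\<lambda>_. {}"] bexI[of _ "{}"]) auto
next
  case (Suc k)
  have "\<delta> / 2 > 0"
    using Suc.prems by simp
  from Suc.IH[OF this] obtain m V X where mVX: "m \<ge> 1" "X \<in> sets \<mu>" "measure \<mu> X < \<delta> / 2"
    "\<And>i e. i < k \<Longrightarrow> e \<in> boundary x0 S - X \<Longrightarrow> e \<in> A i \<longleftrightarrow> vertex m e \<in> V i"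
    by blast
  obtain m' V' X' where mVX': "m' \<ge> 1" "X' \<in> sets \<mu>" "measure \<mu> X' < \<delta> / 2"
    "\<And>e. e \<in> boundary x0 S - X' \<Longrightarrow> e \<in> A k \<longleftrightarrow> vertex m' e \<in> V'"
    using assms(1)[of k] \<open>\<delta> / 2 > 0\<close> unfolding approximable_def by metis
  define W where "W i = (if i < k then {v. ancestor m v \<in> V i} else {v. ancestor m' v \<in> V'})" for i
  have "measure \<mu> (X \<union> X') < \<delta>"
    using measure_Un_le[OF mVX(2) mVX'(2)] mVX(3) mVX'(3) by linarith
  moreover have "e \<in> A i \<longleftrightarrow> vertex (max m m') e \<in> W i"
    if "i < Suc k" "e \<in> boundary x0 S - (X \<union> X')" for i e
    using that mVX(4)[of i e] mVX'(4)[of e] ancestor_vertex[of e m "max m m'"]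
      ancestor_vertex[of e m' "max m m'"]
    by (cases "i < k") (auto simp: W_def less_Suc_eq)
  ultimately show ?case
    using mVX(1,2) mVX'(2)
    by (intro exI[of _ "max m m'"] conjI exI[of _ W] bexI[of _ "X \<union> X'"]) auto
qed

text \<open>Cylinders are decided exactly by their level, complements use the complementary vertex
  set, and a countable union is cut off to a finite one.\<close>

lemma approximable_sets_mu: "A \<in> sets \<mu> \<Longrightarrow> approximable A"
  unfolding sets_mu
proof (induction rule: sigma_sets.induct)
  case (Basic A)
  then obtain v where v: "depth v \<ge> 1" "A = cylinder x0 S v"
    by blast
  show ?case
    unfolding approximable_def v(2)
    using v(1) by (intro allI impI exI[of _ "depth v"] conjI exI[of _ "{v}"] bexI[of _ "{}"])
      (auto simp: cylinder_eq)
next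
  case Empty
  show ?case
    unfolding approximable_def
    by (intro allI impI exI[of _ 1] conjI exI[of _ "{}"] bexI[of _ "{}"]) auto
next
  case (Compl A)
  show ?case
    unfolding approximable_def
  proof (intro allI impI)
    fix \<delta> :: real assume "\<delta> > 0"
    then obtain m V X where "m \<ge> 1" "X \<in> sets \<mu>" "measure \<mu> X < \<delta>"
      "\<And>e. e \<in> boundary x0 S - X \<Longrightarrow> e \<in> A \<longleftrightarrow> vertex m e \<in> V"
      using Compl.IH unfolding approximable_def by metis
    then show "\<exists>m\<ge>1. \<exists>V. \<exists>X\<in>sets \<mu>. measure \<mu> X < \<delta> \<and>
        (\<forall>e\<in>boundary x0 S - X. e \<in> boundary x0 S - A \<longleftrightarrow> vertex m e \<in> V)"
      by (intro exI[of _ m] conjI exI[of _ "- V"] bexI[of _ X]) auto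
  qed
next
  case (Union A)
  have A: "A i \<in> sets \<mu>" for i
    using Union.hyps by (simp add: sets_mu)
  show ?case
    unfolding approximable_def
  proof (intro allI impI)
    fix \<delta> :: real assume "\<delta> > 0"
    then have "\<delta> / 2 > 0"
      by simp
    \<comment> \<open>Half of \<open>\<delta>\<close> pays for the discarded tail of the union, the
      other half for approximating the first \<open>k\<close> sets at once.\<close>
    obtain k where k: "measure \<mu> ((\<Union>i. A i) - (\<Union>i<k. A i)) < \<delta> / 2"
      using measure_UN_tail[of A, OF A \<open>\<delta> / 2 > 0\<close>] by blast
    obtain m V X where mVX: "m \<ge> 1" "X \<in> sets \<mu>" "measure \<mu> X < \<delta> / 2"
      "\<And>i e. i < k \<Longrightarrow> e \<in> boundary x0 S - X \<Longrightarrow> e \<in> A i \<longleftrightarrow> vertex m e \<in> V i"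
      using approximable_family[of A, OF Union.IH \<open>\<delta> / 2 > 0\<close>] by metis
    let ?X = "X \<union> ((\<Union>i. A i) - (\<Union>i<k. A i))"
    have rest: "(\<Union>i. A i) - (\<Union>i<k. A i) \<in> sets \<mu>"
      using A by auto
    then have X: "?X \<in> sets \<mu>"
      using mVX(2) by auto
    have small: "measure \<mu> ?X < \<delta>"
      using measure_Un_le[OF mVX(2) rest] mVX(3) k by linarith
    have iff: "e \<in> (\<Union>i. A i) \<longleftrightarrow> vertex m e \<in> (\<Union>i<k. V i)" if "e \<in> boundary x0 S - ?X" for e
      using that mVX(4)[of _ e] by auto
    show "\<exists>m\<ge>1. \<exists>V. \<exists>X\<in>sets \<mu>. measure \<mu> X < \<delta> \<and>
        (\<forall>e\<in>boundary x0 S - X. e \<in> (\<Union>i. A i) \<longleftrightarrow> vertex m e \<in> V)"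
      by (intro exI[of _ m] conjI exI[of _ "\<Union>i<k. V i"] bexI[of _ ?X] ballI mVX(1) small X) (rule iff)
  qed
qed

text \<open>The null set by which \<open>A\<close> differs from a set of \<open>\<mu>\<close> is
  absorbed into the exceptional set.\<close>

lemma approximable_completion:
  assumes "A \<in> sets (completion \<mu>)"
  shows "approximable A"
proof -
  obtain B N N' where A: "A = B \<union> N" "N \<subseteq> N'" "N' \<in> null_sets \<mu>" "B \<in> sets \<mu>"
    using assms by (rule sets_completionE)
  have N': "N' \<in> sets \<mu>" "measure \<mu> N' = 0"
    using A(3) by (auto simp: measure_def)
  show ?thesis
    unfolding approximable_def
  proof (intro allI impI)
    fix \<delta> :: real assume "\<delta> > 0"
    then obtain m V X where mVX: "m \<ge> 1" "X \<in> sets \<mu>" "measure \<mu> X < \<delta>"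
      "\<And>e. e \<in> boundary x0 S - X \<Longrightarrow> e \<in> B \<longleftrightarrow> vertex m e \<in> V"
      using approximable_sets_mu[OF A(4)] unfolding approximable_def by metis
    moreover have "measure \<mu> (X \<union> N') < \<delta>"
      using measure_Un_le[OF mVX(2) N'(1)] N'(2) mVX(3) by linarith
    ultimately show "\<exists>m\<ge>1. \<exists>V. \<exists>X\<in>sets \<mu>. measure \<mu> X < \<delta> \<and>
        (\<forall>e\<in>boundary x0 S - X. e \<in> A \<longleftrightarrow> vertex m e \<in> V)"
      using A(1,2) N'(1)
      by (intro exI[of _ m] conjI exI[of _ V] bexI[of _ "X \<union> N'"]) auto
  qed
qed

lemma measure_space_completion: "measure (completion \<mu>) (space (completion \<mu>)) = 1"
  using measure_space_mu by simp

text \<open>The preimages of the \<open>\<delta>\<close>-balls around the points of \<open>D\<close>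
  cover the boundary. Finitely many of them cover all but a small set, and these are decided on one
  level \<open>m\<close> up to another small set, so a suitable centre can be chosen from the vertex
  on level \<open>m\<close>.\<close>

lemma L0_approx:
  fixes D :: "nat \<Rightarrow> 'e::metric_space" and \<psi> :: "'v set \<Rightarrow> 'e"
  assumes \<psi>: "\<psi> \<in> L0 (completion \<mu>)" and D: "dense_sequence D" and "\<delta> > 0"
  obtains m p X where "m \<ge> 1" "X \<in> sets (completion \<mu>)" "measure (completion \<mu>) X < \<delta>"
    "\<And>e. e \<in> boundary x0 S - X \<Longrightarrow> dist (p (vertex m e)) (\<psi> e) < \<delta>"
proof -
  interpret C: finite_measure "completion \<mu>"
    using measure_space_completion by (intro finite_measureI) (auto simp: measure_def top_ereal_def)
  have half: "\<delta> / 2 > 0"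
    using \<open>\<delta> > 0\<close> by simp
  define G where "G i = {e \<in> boundary x0 S. dist (D i) (\<psi> e) < \<delta>}" for i
  have "G i = \<psi> -` ball (D i) \<delta> \<inter> space (completion \<mu>)" for i
    by (auto simp: G_def space_mu)
  then have G: "G i \<in> sets (completion \<mu>)" for i
    using \<psi> by (simp add: L0_def in_borel_measurable_borel borel_open del: space_completion)
  have "\<exists>i. e \<in> G i" if "e \<in> boundary x0 S" for e
    using D \<open>\<delta> > 0\<close> that unfolding G_def dense_sequence_def mem_Collect_eq by (metis dist_commute)
  then have UN: "(\<Union>i. G i) = boundary x0 S"
    by (auto simp: G_def)
  obtain k where k: "measure (completion \<mu>) ((\<Union>i. G i) - (\<Union>i<k. G i)) < \<delta> / 2"
    using C.measure_UN_tail[of G, OF G half] by blast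
  obtain m V X where mVX: "m \<ge> 1" "X \<in> sets \<mu>" "measure \<mu> X < \<delta> / 2"
    "\<And>i e. i < k \<Longrightarrow> e \<in> boundary x0 S - X \<Longrightarrow> e \<in> G i \<longleftrightarrow> vertex m e \<in> V i"
    using approximable_family[of G, OF approximable_completion[OF G] half] by metis
  let ?X = "X \<union> ((\<Union>i. G i) - (\<Union>i<k. G i))"
  \<comment> \<open>Off \<open>?X\<close> the vertex lies in some \<open>V i\<close> with
    \<open>i < k\<close>, so the choice succeeds there; elsewhere \<open>p\<close> is
    arbitrary.\<close>
  define p where "p v = D (SOME i. i < k \<and> v \<in> V i)" for v
  have rest: "(\<Union>i. G i) - (\<Union>i<k. G i) \<in> sets (completion \<mu>)"
    using G by auto
  have X: "?X \<in> sets (completion \<mu>)"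
    using rest mVX(2) by (intro sets.Un) auto
  have small: "measure (completion \<mu>) ?X < \<delta>"
    using measure_Un_le[OF sets_completionI_sets[OF mVX(2)] rest] mVX(2,3) k
    by simp
  have "dist (p (vertex m e)) (\<psi> e) < \<delta>" if e: "e \<in> boundary x0 S - ?X" for e
  proof -
    have "\<exists>i<k. e \<in> G i"
      using e UN by auto
    then have "\<exists>i. i < k \<and> vertex m e \<in> V i"
      using mVX(4) e by blast
    from someI_ex[OF this] obtain i where "i < k" "vertex m e \<in> V i" "p (vertex m e) = D i"
      unfolding p_def by blast
    then show ?thesis
      using mVX(4)[of i e] e by (simp add: G_def)
  qed
  with that mVX(1) X small show thesis
    by blast
qed

text \<open>The function depends only on the vertex on level \<open>n\<close>, so the preimage of
  any set is a finite union of cylinders.\<close>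

lemma level_fun_in_L0: "level_fun x0 S n f \<in> L0 (completion \<mu>)" if "n \<ge> 1"
proof -
  have "level_fun x0 S n f -` A \<inter> space (completion \<mu>) \<in> sets (completion \<mu>)" for A
  proof -
    have "level_fun x0 S n f -` A \<inter> space (completion \<mu>) = {e \<in> boundary x0 S. vertex n e \<in> f -` A}"
      by (auto simp: level_fun_eq space_mu)
    then show ?thesis
      using vertex_preimage_in_sets[OF that] by (metis sets_completionI_sets)
  qed
  then show ?thesis
    by (simp add: L0_def borel_measurableI)
qed

section \<open>Universality and density of the family\<close>

text \<open>In a late block whose task names \<open>j\<close>, all other members of \<open>A\<close>
  are steered to 0, so at the end of the block only the \<open>j\<close>-th term remains off a small
  set.\<close>

lemma universal_combination:
  fixes D :: "nat \<Rightarrow> 'e::complex_normed_vector"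
  assumes D: "dense_sequence D" and z: "bij z" and A: "finite A" "j \<in> A" and c: "c j \<noteq> 0"
  shows "(\<Sum>i\<in>A. scaleC_fun (c i) (family D z i)) \<in> universal x0 S w (completion \<mu>)"
proof -
  interpret VS: vector_space "scaleC_fun :: complex \<Rightarrow> ('v \<Rightarrow> 'e) \<Rightarrow> 'v \<Rightarrow> 'e"
    by (rule vector_space_scaleC_fun)
  let ?M = "completion \<mu>"
  define F where "F = (\<Sum>i\<in>A. scaleC_fun (c i) (family D z i))"
  have "F \<in> harmonic S w"
    unfolding F_def family_def
    by (intro VS.subspace_sum VS.subspace_scale subspace_harmonic harmonic_harmonic_ext)
  moreover have "dense_in (L0_dist ?M) {level_fun x0 S n F | n. n \<ge> 1} (L0 ?M)"
    unfolding dense_in_def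
  proof (intro conjI ballI allI impI)
    show "{level_fun x0 S n F | n. n \<ge> 1} \<subseteq> L0 ?M"
      using level_fun_in_L0 by blast
  next
    fix \<psi> :: "'v set \<Rightarrow> 'e" and \<epsilon> :: real
    assume \<psi>: "\<psi> \<in> L0 ?M" and "\<epsilon> > 0"
    \<comment> \<open>Two quarters pay for the distances through \<open>p\<close>, one for the
      measure of \<open>X\<close> and one for the exceptional set.\<close>
    define \<delta> where "\<delta> = \<epsilon> / 4"
    have "\<delta> > 0"
      using \<open>\<epsilon> > 0\<close> by (simp add: \<delta>_def)
    obtain m p X where mpX: "m \<ge> 1" "X \<in> sets ?M" "measure ?M X < \<delta>"
      "\<And>e. e \<in> boundary x0 S - X \<Longrightarrow> dist (p (vertex m e)) (\<psi> e) < \<delta>"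
      using L0_approx[OF \<psi> D \<open>\<delta> > 0\<close>] by metis
    \<comment> \<open>Member \<open>j\<close> is steered to \<open>p\<close> divided by
      \<open>c j\<close>; the tolerance anticipates the later multiplication by
      \<open>c j\<close>.\<close>
    have "\<delta> / cmod (c j) > 0"
      using \<open>\<delta> > 0\<close> c by simp
    then obtain ys where ys: "\<And>v. v \<in> level x0 S m \<Longrightarrow>
        dist (inverse (c j) *\<^sub>C p v) (decode D z ys v) < \<delta> / cmod (c j)"
      using decode_approx[OF D z finite_level[of m], where p = "\<lambda>v. inverse (c j) *\<^sub>C p v"] by metis
    have ys': "dist (c j *\<^sub>C decode D z ys v) (p v) < \<delta>" if "v \<in> level x0 S m" for v
    proof -
      have "p v - c j *\<^sub>C decode D z ys v = c j *\<^sub>C (inverse (c j) *\<^sub>C p v - decode D z ys v)"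
        using c by (simp add: scaleC_diff_right scaleC_scaleC scaleC_one)
      then show ?thesis
        using ys[OF that] c
        by (simp add: dist_norm norm_minus_commute norm_scaleC pos_less_divide_eq mult.commute)
    qed
    obtain T where T: "(1 / 2 :: real) ^ T < \<delta>"
      using real_arch_pow_inv[OF \<open>\<delta> > 0\<close>, of "1 / 2"] by auto
    let ?task = "\<lambda>k. to_nat ((j, m, ys, k) :: task)"
    \<comment> \<open>A block number above \<open>B\<close> places the block below level
      \<open>m\<close> and below the initial parts of all members of \<open>A\<close>, and makes it
      long enough for the exceptional set to have measure below \<open>\<delta>\<close>.\<close>
    define B where "B = m + T + (\<Sum>i\<in>A. fst (snd i))"
    have "infinite (range ?task)"
      by (rule range_inj_infinite) (auto simp: inj_on_def)
    then obtain k where k: "B < ?task k"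
      unfolding infinite_nat_iff_unbounded by blast
    define t where "t = ?task k"
    define n :: nat where "n = 2 ^ t"
    have "t < n"
      by (simp add: n_def less_exp)
    then have n: "m \<le> n" "T \<le> n" "n \<ge> 1"
      using k by (auto simp: B_def t_def)
    have n': "fst (snd i) \<le> n" if "i \<in> A" for i
    proof -
      have "fst (snd i) \<le> (\<Sum>i\<in>A. fst (snd i))"
        using that A(1) by (intro member_le_sum) auto
      then show ?thesis
        using k \<open>t < n\<close> by (simp add: B_def t_def)
    qed
    have F: "F (vertex (n + n) e) = c j *\<^sub>C decode D z ys (vertex m e)"
      if e: "e \<in> boundary x0 S" "e \<notin> exceptional n n" for e
    proof -
      define x where "x = vertex (n + n) e"
      have x: "depth x = 2 ^ Suc t" "x \<noteq> (s ^^ (2 ^ t)) (ancestor (2 ^ t) x)"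
        using e by (auto simp: x_def n_def depth_vertex exceptional_def ancestor_vertex)
      have "family D z i x = (if i = j then decode D z ys (ancestor m x) else 0)" if "i \<in> A" for i
        using n n'[OF that] x by (intro family_eq_target[OF t_def]) (auto simp: n_def)
      then have "F x = (\<Sum>i\<in>A. if i = j then c j *\<^sub>C decode D z ys (ancestor m x) else 0)"
        unfolding F_def sum_scaleC_fun_apply by (intro sum.cong) (auto simp: scaleC_zero_right)
      then show ?thesis
        using A n e by (simp add: x_def ancestor_vertex)
    qed
    let ?X = "X \<union> exceptional n n"
    have exc: "exceptional n n \<in> sets ?M" "measure ?M (exceptional n n) < \<delta>"
    proof -
      have "(1 / 2 :: real) ^ n \<le> (1 / 2) ^ T"
        using n by (intro power_decreasing) auto
      then have "measure \<mu> (exceptional n n) < \<delta>"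
        using measure_exceptional[OF n(3), of n] T by linarith
      then show "measure ?M (exceptional n n) < \<delta>"
        using exceptional_in_sets[OF n(3)] by simp
    qed (use exceptional_in_sets n in auto)
    have "L0_dist ?M (level_fun x0 S (n + n) F) \<psi> \<le> 2 * \<delta> + measure ?M ?X"
    proof (rule L0_dist_le[OF measure_space_completion])
      fix e assume "e \<in> space ?M - ?X"
      then have e: "e \<in> boundary x0 S - X" "e \<in> boundary x0 S" "e \<notin> exceptional n n"
        by (auto simp: space_mu)
      have "dist (F (vertex (n + n) e)) (p (vertex m e)) < \<delta>"
        using ys'[of "vertex m e"] F[OF e(2,3)] depth_vertex[OF e(2)] by (simp add: level_eq)
      then show "dist (level_fun x0 S (n + n) F e) (\<psi> e) \<le> 2 * \<delta>"
        using mpX(4)[OF e(1)] dist_triangle[of "F (vertex (n + n) e)" "\<psi> e" "p (vertex m e)"]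
        by (simp add: level_fun_eq)
    qed (use mpX exc \<open>\<delta> > 0\<close> in auto)
    also have "\<dots> < 4 * \<delta>"
      using measure_Un_le[OF mpX(2) exc(1)] mpX(3) exc(2) by linarith
    finally show "\<exists>a\<in>{level_fun x0 S n F | n. n \<ge> 1}. L0_dist ?M a \<psi> < \<epsilon>"
      using n(3) by (auto simp: \<delta>_def intro!: exI[of _ "n + n"])
  qed
  ultimately show ?thesis
    by (simp add: universal_def F_def)
qed

text \<open>The constant function \<open>a\<close> keeps the fixed positive distance
  \<open>norm a / (1 + norm a)\<close> from all level functions of 0.\<close>

lemma zero_not_universal:
  assumes "(a :: 'e::complex_normed_vector) \<noteq> 0"
  shows "(0 :: 'v \<Rightarrow> 'e) \<notin> universal x0 S w (completion \<mu>)"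
proof
  assume "(0 :: 'v \<Rightarrow> 'e) \<in> universal x0 S w (completion \<mu>)"
  moreover have "(\<lambda>_. a) \<in> L0 (completion \<mu>)"
    by (simp add: L0_def)
  moreover have "norm a / (1 + norm a) > 0"
    using assms by (simp add: add_pos_pos)
  ultimately obtain n where
    "L0_dist (completion \<mu>) (level_fun x0 S n (0 :: 'v \<Rightarrow> 'e)) (\<lambda>_. a) < norm a / (1 + norm a)"
    unfolding universal_def dense_in_def by blast
  then show False
    using measure_space_mu by (simp add: L0_dist_def level_fun_def)
qed

text \<open>Only \<open>k\<close> vertices matter up to \<open>\<epsilon> / 2\<close>. Free values
  close to those of \<open>h\<close> down to a depth containing these vertices suffice, by
  \<open>harmonic_bound\<close> applied to the difference.\<close>

lemma family_dense:
  fixes D :: "nat \<Rightarrow> 'e::complex_normed_vector"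
  assumes D: "dense_sequence D" and z: "bij z" and h: "h \<in> harmonic S w" and "\<epsilon> > 0"
  shows "\<exists>n xs. pointwise_dist z (family D z (b, n, xs)) h < \<epsilon>"
proof -
  interpret VS: vector_space "scaleC_fun :: complex \<Rightarrow> ('v \<Rightarrow> 'e) \<Rightarrow> 'v \<Rightarrow> 'e"
    by (rule vector_space_scaleC_fun)
  obtain k where k: "(1 / 2 :: real) ^ k < \<epsilon> / 2"
    using real_arch_pow_inv[of "\<epsilon> / 2" "1 / 2"] \<open>\<epsilon> > 0\<close> by auto
  let ?P = "\<lambda>v C. C > 0 \<and> (\<forall>u\<in>harmonic S w. \<forall>\<delta>.
      (\<forall>y. y \<notin> range s \<longrightarrow> depth y \<le> depth v \<longrightarrow> norm (u y :: 'e) \<le> \<delta>) \<longrightarrow> norm (u v) \<le> C * \<delta>)"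
  have "\<forall>v. \<exists>C. ?P v C"
    using harmonic_bound by blast
  from choice[OF this] obtain C where "\<forall>v. ?P v (C v)" ..
  then have C: "\<And>v. C v > 0" "\<And>v u \<delta>. u \<in> harmonic S w \<Longrightarrow>
      (\<And>y. y \<notin> range s \<Longrightarrow> depth y \<le> depth v \<Longrightarrow> norm (u y :: 'e) \<le> \<delta>) \<Longrightarrow> norm (u v) \<le> C v * \<delta>"
    by blast+
  \<comment> \<open>The summand 1 keeps \<open>B\<close> positive even for \<open>k = 0\<close>, as
    the division in \<open>\<delta>\<close> requires.\<close>
  define B where "B = 1 + (\<Sum>n<k. C (z n))"
  define N where "N = (\<Sum>n<k. depth (z n))"
  have B: "C (z n) \<le> B" and N: "depth (z n) \<le> N" if "n < k" for n
  proof -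
    have "C (z n) \<le> (\<Sum>n<k. C (z n))"
      using that C(1) by (intro member_le_sum) (auto intro: less_imp_le)
    then show "C (z n) \<le> B"
      by (simp add: B_def)
    show "depth (z n) \<le> N"
      using that unfolding N_def by (intro member_le_sum[where f = "\<lambda>n. depth (z n)"]) auto
  qed
  have "B > 0"
    using C(1) by (simp add: B_def add_pos_nonneg sum_nonneg less_imp_le)
  define \<delta> where "\<delta> = \<epsilon> / (2 * B)"
  have "\<delta> > 0"
    using \<open>B > 0\<close> \<open>\<epsilon> > 0\<close> by (simp add: \<delta>_def)
  have "{v. depth v \<le> N} = (\<Union>n\<le>N. level x0 S n)"
    by (auto simp: level_eq)
  then have "finite {v. depth v \<le> N}"
    using finite_level by simp
  then obtain xs where xs: "\<And>v. depth v \<le> N \<Longrightarrow> dist (h v) (decode D z xs v) < \<delta>"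
    using decode_approx[OF D z _ \<open>\<delta> > 0\<close>, of "{v. depth v \<le> N}" h] by auto
  let ?f = "family D z (b, N, xs)"
  have u: "?f - h \<in> harmonic S w"
    unfolding family_def by (intro VS.subspace_diff subspace_harmonic harmonic_harmonic_ext h)
  have "dist (?f (z n)) (h (z n)) \<le> \<epsilon> / 2" if "n < k" for n
  proof -
    have "norm ((?f - h) y) \<le> \<delta>" if "y \<notin> range s" "depth y \<le> depth (z n)" for y
    proof -
      have "depth y \<le> N"
        using that N[OF \<open>n < k\<close>] by simp
      then show ?thesis
        using xs[of y] that
        by (simp add: family_def harmonic_ext_not_s free_values_def dist_norm norm_minus_commute)
    qed
    then have "norm ((?f - h) (z n)) \<le> C (z n) * \<delta>"
      using C(2)[OF u] by blast
    also have "\<dots> \<le> B * \<delta>"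
      using B[OF that] \<open>\<delta> > 0\<close> by simp
    also have "\<dots> = \<epsilon> / 2"
      using \<open>B > 0\<close> by (simp add: \<delta>_def)
    finally show ?thesis
      by (simp add: dist_norm)
  qed
  then have "pointwise_dist z ?f h \<le> \<epsilon> / 2 + (1 / 2) ^ k"
    using \<open>\<epsilon> > 0\<close> by (intro pointwise_dist_le) auto
  then show ?thesis
    using k by (intro exI[of _ N] exI[of _ xs]) simp
qed

section \<open>The two spans and their intersection\<close>

text \<open>Span elements are sums over functions, but universality speaks of coefficients at
  indices. Choosing \<open>A\<close> with the family injective on it allows the sum to be
  reindexed.\<close>

lemma span_family:
  fixes D :: "nat \<Rightarrow> 'e::complex_normed_vector"
  assumes "f \<in> module.span scaleC_fun (family D z ` J)"
  obtains A c where "finite A" "A \<subseteq> J" "f = (\<Sum>i\<in>A. scaleC_fun (c i) (family D z i))"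
proof -
  interpret VS: vector_space "scaleC_fun :: complex \<Rightarrow> ('v \<Rightarrow> 'e) \<Rightarrow> 'v \<Rightarrow> 'e"
    by (rule vector_space_scaleC_fun)
  obtain G r where G: "finite G" "G \<subseteq> family D z ` J" and f: "f = (\<Sum>g\<in>G. scaleC_fun (r g) g)"
    using assms unfolding VS.span_explicit by blast
  obtain A where "A \<subseteq> J" "finite A" "G = family D z ` A" "inj_on (family D z) A"
    using G by (metis finite_imageD finite_subset subset_image_inj)
  then show thesis
    using f by (intro that[of A "\<lambda>i. r (family D z i)"]) (auto simp: sum.reindex)
qed

text \<open>Each half of the family spans one space. A nonzero common element would give two
  representations with disjoint index sets, whose difference vanishes although it has a nonzero
  coefficient and hence is universal.\<close>

lemma universal_subspaces:
  fixes D :: "nat \<Rightarrow> 'e::complex_normed_vector"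
  assumes D: "dense_sequence D" and z: "bij z"
  shows "\<exists>F1 F2 :: ('v \<Rightarrow> 'e) set.
    module.subspace scaleC_fun F1 \<and> module.subspace scaleC_fun F2 \<and>
    F1 \<subseteq> universal x0 S w (completion \<mu>) \<union> {0} \<and>
    F2 \<subseteq> universal x0 S w (completion \<mu>) \<union> {0} \<and>
    dense_in (pointwise_dist z) F1 (harmonic S w) \<and>
    dense_in (pointwise_dist z) F2 (harmonic S w) \<and>
    F1 \<inter> F2 = {0}"
proof -
  interpret VS: vector_space "scaleC_fun :: complex \<Rightarrow> ('v \<Rightarrow> 'e) \<Rightarrow> 'v \<Rightarrow> 'e"
    by (rule vector_space_scaleC_fun)
  let ?U = "universal x0 S w (completion \<mu>) :: ('v \<Rightarrow> 'e) set"
  let ?comb = "\<lambda>A c. \<Sum>i\<in>A. scaleC_fun (c i) (family D z i)"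
  define F where "F b = VS.span (family D z ` ({b} \<times> UNIV))" for b
  have nonzero: "\<exists>j\<in>A. c j \<noteq> 0" if "?comb A c \<noteq> 0" for A c
    using that by (metis (no_types, lifting) VS.scale_zero_left sum.neutral)
  have "F b \<subseteq> ?U \<union> {0}" for b
  proof
    fix f assume "f \<in> F b"
    then obtain A c where A: "finite A" and f: "f = ?comb A c"
      unfolding F_def by (rule span_family)
    show "f \<in> ?U \<union> {0}"
      using nonzero[of c A] universal_combination[OF D z A] f by blast
  qed
  moreover have "dense_in (pointwise_dist z) (F b) (harmonic S w)" for b
    unfolding dense_in_def
  proof (intro conjI ballI allI impI)
    have "family D z i \<in> harmonic S w" for i
      unfolding family_def by (rule harmonic_harmonic_ext)
    then show "F b \<subseteq> harmonic S w"
      unfolding F_def by (intro VS.span_minimal subspace_harmonic) auto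
  next
    fix h :: "'v \<Rightarrow> 'e" and \<epsilon> :: real
    assume "h \<in> harmonic S w" "\<epsilon> > 0"
    then obtain n xs where "pointwise_dist z (family D z (b, n, xs)) h < \<epsilon>"
      using family_dense[OF D z] by blast
    moreover have "family D z (b, n, xs) \<in> F b"
      unfolding F_def by (intro VS.span_base) auto
    ultimately show "\<exists>f\<in>F b. pointwise_dist z f h < \<epsilon>"
      by blast
  qed
  moreover have "F True \<inter> F False = {0}"
  proof -
    have "f = 0" if f: "f \<in> F True" "f \<in> F False" for f
    proof (rule ccontr)
      assume "f \<noteq> 0"
      obtain A c where A: "finite A" "A \<subseteq> {True} \<times> UNIV" "f = ?comb A c"
        using f(1) unfolding F_def by (rule span_family)
      obtain B d where B: "finite B" "B \<subseteq> {False} \<times> UNIV" "f = ?comb B d"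
        using f(2) unfolding F_def by (rule span_family)
      obtain j where j: "j \<in> A" "c j \<noteq> 0"
        using nonzero[of c A] A(3) \<open>f \<noteq> 0\<close> by blast
      have disjoint: "A \<inter> B = {}"
        using A(2) B(2) by auto
      \<comment> \<open>The second representation enters with opposite sign, so the combined sum is
        \<open>f - f\<close>.\<close>
      define c' where "c' i = (if i \<in> A then c i else - d i)" for i
      have "?comb (A \<union> B) c' = ?comb A c' + ?comb B c'"
        using A(1) B(1) disjoint by (rule sum.union_disjoint)
      also have "?comb A c' = f"
        unfolding A(3) by (intro sum.cong) (auto simp: c'_def)
      also have "?comb B c' = - f"
        unfolding B(3) sum_negf[symmetric] using disjoint
        by (intro sum.cong) (auto simp: c'_def VS.scale_minus_left)
      finally have "?comb (A \<union> B) c' = 0"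
        by (simp only: right_minus)
      moreover have "?comb (A \<union> B) c' \<in> ?U"
        using A(1) B(1) j by (intro universal_combination[OF D z, of _ j]) (auto simp: c'_def)
      \<comment> \<open>A nonzero value of \<open>f\<close> provides the nonzero vector for
        \<open>zero_not_universal\<close>, so a trivial \<open>E\<close> needs no separate
        case.\<close>
      moreover obtain v where "f v \<noteq> 0"
        using \<open>f \<noteq> 0\<close> by (auto simp: fun_eq_iff)
      ultimately show False
        using zero_not_universal by metis
    qed
    moreover have "0 \<in> F b" for b
      unfolding F_def by (rule VS.span_zero)
    ultimately show ?thesis
      by blast
  qed
  moreover have "VS.subspace (F b)" for b
    unfolding F_def by (rule VS.subspace_span)
  ultimately show ?thesis
    by (intro exI[of _ "F True"] exI[of _ "F False"] conjI)
qed

end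

section \<open>Light children and an enumerated dense set\<close>

theorem theorem3p5:
  fixes x0 :: 'v
    and S :: "'v \<Rightarrow> 'v set"
    and q :: "'v \<Rightarrow> 'v \<Rightarrow> real"
    and w :: "'v \<Rightarrow> 'v \<Rightarrow> complex"
    and \<mu> :: "'v set measure"
    and z :: "nat \<Rightarrow> 'v"
  assumes "rooted_tree x0 S"
    and "\<And>n. finite (level x0 S n)"
    and "\<And>x. card (S x) \<ge> 2"
    and "\<And>x y. y \<in> S x \<Longrightarrow> q x y > 0"
    and "\<And>x. (\<Sum>y\<in>S x. q x y) = 1"
    and "\<And>x y. y \<in> S x \<Longrightarrow> w x y \<noteq> 0"
    and "\<And>x. (\<Sum>y\<in>S x. w x y) = 1"
    and "kolmogorov_extension x0 S q \<mu>"
    and "bij z"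
    and separable: "\<exists>D :: 'e::complex_normed_vector set. countable D \<and> closure D = UNIV"
  shows "\<exists>F1 F2 :: ('v \<Rightarrow> 'e) set.
    module.subspace scaleC_fun F1 \<and> module.subspace scaleC_fun F2 \<and>
    F1 \<subseteq> universal x0 S w (completion \<mu>) \<union> {0} \<and>
    F2 \<subseteq> universal x0 S w (completion \<mu>) \<union> {0} \<and>
    dense_in (pointwise_dist z) F1 (harmonic S w) \<and>
    dense_in (pointwise_dist z) F2 (harmonic S w) \<and>
    F1 \<inter> F2 = {0}"
proof -
  have finite_S: "finite (S x)" for x
    using assms(3)[of x] by (metis card.infinite not_numeral_le_zero)
  \<comment> \<open>Two distinct children have total probability at most 1, so one of them has at
    most 1/2.\<close>
  have "\<forall>x. \<exists>y. y \<in> S x \<and> q x y \<le> 1 / 2"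
  proof
    fix x
    have "\<not> card (S x) \<le> Suc 0"
      using assms(3)[of x] by simp
    then obtain a b where ab: "a \<in> S x" "b \<in> S x" "a \<noteq> b"
      using card_le_Suc0_iff_eq[OF finite_S] by blast
    have "(\<Sum>y\<in>{a, b}. q x y) \<le> (\<Sum>y\<in>S x. q x y)"
      using ab assms(4)[of _ x] finite_S by (intro sum_mono2) (auto intro: less_imp_le)
    then have "q x a + q x b \<le> 1"
      using ab assms(5)[of x] by simp
    then have "q x a \<le> 1 / 2 \<or> q x b \<le> 1 / 2"
      by linarith
    with ab show "\<exists>y. y \<in> S x \<and> q x y \<le> 1 / 2"
      by blast
  qed
  from choice[OF this] obtain s where s: "\<And>x. s x \<in> S x" "\<And>x. q x (s x) \<le> 1 / 2"
    by blast
  interpret boundary_measure x0 S w s q \<mu>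
    using assms(1,2,4,6,7,8) finite_S s by unfold_locales
  obtain E0 :: "'e set" where E0: "countable E0" "closure E0 = UNIV"
    using separable by blast
  \<comment> \<open>Nonemptiness makes \<open>from_nat_into\<close> enumerate exactly
    \<open>E0\<close>, with repetitions if \<open>E0\<close> is finite.\<close>
  then have "E0 \<noteq> {}"
    by auto
  have "\<exists>i. dist x (from_nat_into E0 i) < \<epsilon>" if pos: "\<epsilon> > 0" for x and \<epsilon> :: real
  proof -
    have "x \<in> closure E0"
      using E0 by simp
    then obtain y where "y \<in> E0" "dist y x < \<epsilon>"
      using pos closure_approachable by metis
    then show ?thesis
      using range_from_nat_into[OF \<open>E0 \<noteq> {}\<close> E0(1)] by (metis dist_commute rangeE)
  qed
  then have "dense_sequence (from_nat_into E0)"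
    by (simp add: dense_sequence_def)
  then show ?thesis
    using assms(9) by (rule universal_subspaces)
qed

end
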